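(* Let $T$ be a left continuous t-norm with R-implication $I_T$, let $A,A',A'',A_1$ be fuzzy sets on $U$, let $B,B_1$ be fuzzy sets on $V$, and let $\alpha_1,\alpha_2,\alpha_3\in[0,1]$. Define, for $y\in V$, $$B'_1(y)=\sup_{x\in U}I_T\bigl(S_F(A',A),T(A(x),B(y))\bigr),\qquad B''_1(y)=\sup_{x\in U}I_T\bigl(S_F(A'',A_1),T(A_1(x),B_1(y))\bigr).$$ If $A'\sim^{S_F}_{\alpha_1}A''$, $A\sim^{S_F}_{\alpha_2}A_1$ and $B\sim^{S_F}_{\alpha_3}B_1$, then $B_1'\sim^{S_F}_{T(\beta,\alpha_2,\alpha_3)}B_1''$, where $\beta=F\bigl(S_F(A',A),S_F(A'',A_1)\bigr)$.
   Context: A t-norm is a commutative, associative map $T:[0,1]^2\to[0,1]$, non-decreasing in each variable, with neutral element $1$; $T(a,b,c)=T(T(a,b),c)$. Its R-implication is $I_T(x,y)=\sup\{a\in[0,1]\mid T(x,a)\le y\}$. Put $F(x,y)=T(I_T(x,y),I_T(y,x))$ for $x,y\in[0,1]$. A fuzzy set on a nonempty universe $W$ is a map $W\to[0,1]$; for fuzzy sets $C,D$ on $W$, $S_F(C,D)=\inf_{w\in W}F(C(w),D(w))$, and $C\sim^{S_F}_\alpha D$ means $S_F(C,D)\ge\alpha$. *)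

theory Defs
  imports Complex_Main
begin

text \<open>
  Operations on the unit interval are total functions on the reals of which only the values on
  [0,1] are constrained; a fuzzy set on a universe \<open>W\<close> is a real function mapping \<open>W\<close> into [0,1].
\<close>

definition t_norm :: "(real \<Rightarrow> real \<Rightarrow> real) \<Rightarrow> bool" where
  "t_norm T \<longleftrightarrow>
     (\<forall>x\<in>{0..1}. \<forall>y\<in>{0..1}. T x y \<in> {0..1}) \<and>
     (\<forall>x\<in>{0..1}. \<forall>y\<in>{0..1}. T x y = T y x) \<and>
     (\<forall>x\<in>{0..1}. \<forall>y\<in>{0..1}. \<forall>z\<in>{0..1}. T (T x y) z = T x (T y z)) \<and>
     (\<forall>z\<in>{0..1}. mono_on {0..1} (T z) \<and> mono_on {0..1} (\<lambda>x. T x z)) \<and>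
     (\<forall>x\<in>{0..1}. T x 1 = x \<and> T 1 x = x)"

text \<open>
  Left continuity in each variable. The left endpoint 0 is excluded because there is nothing
  in [0,1] to its left.
\<close>

definition left_continuous_op :: "(real \<Rightarrow> real \<Rightarrow> real) \<Rightarrow> bool" where
  "left_continuous_op T \<longleftrightarrow>
     (\<forall>z\<in>{0..1}. \<forall>x\<in>{0<..1}.
        continuous (at_left x) (T z) \<and> continuous (at_left x) (\<lambda>a. T a z))"

definition T3 :: "(real \<Rightarrow> real \<Rightarrow> real) \<Rightarrow> real \<Rightarrow> real \<Rightarrow> real \<Rightarrow> real" where
  "T3 T a b c = T (T a b) c"

definition R_impl :: "(real \<Rightarrow> real \<Rightarrow> real) \<Rightarrow> real \<Rightarrow> real \<Rightarrow> real" where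
  "R_impl T x y = Sup {a \<in> {0..1}. T x a \<le> y}"

definition bi_impl :: "(real \<Rightarrow> real \<Rightarrow> real) \<Rightarrow> real \<Rightarrow> real \<Rightarrow> real" where
  "bi_impl T x y = T (R_impl T x y) (R_impl T y x)"

definition fuzzy_set_on :: "'w set \<Rightarrow> ('w \<Rightarrow> real) \<Rightarrow> bool" where
  "fuzzy_set_on W C \<longleftrightarrow> (\<forall>w\<in>W. C w \<in> {0..1})"

definition sim_deg :: "(real \<Rightarrow> real \<Rightarrow> real) \<Rightarrow> 'w set \<Rightarrow> ('w \<Rightarrow> real) \<Rightarrow> ('w \<Rightarrow> real) \<Rightarrow> real" where
  "sim_deg F W C D = (INF w\<in>W. F (C w) (D w))"

definition similar ::
  "(real \<Rightarrow> real \<Rightarrow> real) \<Rightarrow> 'w set \<Rightarrow> real \<Rightarrow> ('w \<Rightarrow> real) \<Rightarrow> ('w \<Rightarrow> real) \<Rightarrow> bool" where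
  "similar F W \<alpha> C D \<longleftrightarrow> sim_deg F W C D \<ge> \<alpha>"

end

theory Submission
  imports Defs
begin

text \<open>
  Left continuity makes \<open>R_impl T\<close> the residuum of \<open>T\<close>: \<open>a \<le> R_impl T x y\<close> iff \<open>T x a \<le> y\<close>. Since
  [0,1] is a chain, one of the two factors of \<open>bi_impl T x y\<close> is always 1, and so the lower bounds
  of a biimplication are characterised by a pair of inequalities that mention only \<open>T\<close>:
  \<open>t \<le> bi_impl T x y\<close> iff \<open>T t x \<le> y\<close> and \<open>T t y \<le> x\<close> (lemma \<open>le_bi_impl_iff\<close>). A degree \<open>t\<close> is
  thus a factor that pushes each of \<open>x\<close>, \<open>y\<close> below the other.

  In this form it is easy to see how degrees pass through the three operations from which
  the two conclusions are built. If \<open>t\<close> pushes \<open>a\<close> below \<open>a'\<close> and \<open>s\<close> pushes \<open>b\<close>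
  below \<open>b'\<close>, then \<open>T t s\<close> pushes \<open>T a b\<close> below \<open>T a' b'\<close>; the residuum behaves likewise, with the
  direction reversed in its first argument; and a common factor for a family of pairs is a factor
  for their suprema. Applying the first rule to \<open>\<alpha>2\<close> and \<open>\<alpha>3\<close>, the second
  to \<open>\<beta>\<close> and \<open>T \<alpha>2 \<alpha>3\<close>, and the third to the supremum over \<open>U\<close> shows that \<open>T \<beta> (T \<alpha>2 \<alpha>3)\<close> is
  a lower bound of the biimplication of the two conclusions at every point of \<open>V\<close>. The two
  inequalities needed at a point are instances of one statement with the two sides interchanged.
\<close>

section \<open>T-norms and residuation\<close>

locale left_continuous_t_norm =
  fixes T :: "real \<Rightarrow> real \<Rightarrow> real"
  assumes t_norm: "t_norm T" and left_continuous: "left_continuous_op T"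
begin

lemma closed: "\<lbrakk>x \<in> {0..1}; y \<in> {0..1}\<rbrakk> \<Longrightarrow> T x y \<in> {0..1}"
  using t_norm unfolding t_norm_def by blast

lemma commute: "\<lbrakk>x \<in> {0..1}; y \<in> {0..1}\<rbrakk> \<Longrightarrow> T x y = T y x"
  using t_norm unfolding t_norm_def by blast

lemma assoc: "\<lbrakk>x \<in> {0..1}; y \<in> {0..1}; z \<in> {0..1}\<rbrakk> \<Longrightarrow> T (T x y) z = T x (T y z)"
  using t_norm unfolding t_norm_def by blast

lemma one [simp]: "x \<in> {0..1} \<Longrightarrow> T x 1 = x" "x \<in> {0..1} \<Longrightarrow> T 1 x = x"
  using t_norm unfolding t_norm_def by blast+

lemma mono_right:
  "\<lbrakk>z \<in> {0..1}; x \<in> {0..1}; y \<in> {0..1}; x \<le> y\<rbrakk> \<Longrightarrow> T z x \<le> T z y"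
  using t_norm unfolding t_norm_def mono_on_def by blast

lemma mono_left:
  "\<lbrakk>z \<in> {0..1}; x \<in> {0..1}; y \<in> {0..1}; x \<le> y\<rbrakk> \<Longrightarrow> T x z \<le> T y z"
  using t_norm unfolding t_norm_def mono_on_def by blast

lemma mono:
  assumes "x \<in> {0..1}" "x' \<in> {0..1}" "y \<in> {0..1}" "y' \<in> {0..1}" "x \<le> x'" "y \<le> y'"
  shows "T x y \<le> T x' y'"
  using mono_left[of y x x'] mono_right[of x' y y'] assms by linarith

lemma le_right: "\<lbrakk>x \<in> {0..1}; y \<in> {0..1}\<rbrakk> \<Longrightarrow> T x y \<le> y"
  using mono_left[of y x 1] by simp

lemma zero: "x \<in> {0..1} \<Longrightarrow> T x 0 = 0"
  using le_right[of x 0] closed[of x 0] by simp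

lemma interchange:
  assumes "a \<in> {0..1}" "b \<in> {0..1}" "c \<in> {0..1}" "d \<in> {0..1}"
  shows "T (T a b) (T c d) = T (T a c) (T b d)"
proof -
  have "T b (T c d) = T c (T b d)"
    using assms by (simp only: assoc[symmetric] commute[of b c])
  then show ?thesis
    using assms by (simp only: assoc closed)
qed

lemma R_impl_closed:
  assumes "x \<in> {0..1}" "y \<in> {0..1}"
  shows "R_impl T x y \<in> {0..1}"
proof -
  let ?S = "{a \<in> {0..1}. T x a \<le> y}"
  have "0 \<in> ?S"
    using assms by (simp add: zero)
  moreover have "bdd_above ?S"
    by (rule bdd_aboveI[of _ 1]) simp
  ultimately have "0 \<le> Sup ?S"
    by (rule cSup_upper)
  moreover have "Sup ?S \<le> 1"
    using \<open>0 \<in> ?S\<close> by (intro cSup_least; blast?) simp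
  ultimately show ?thesis
    by (simp add: R_impl_def)
qed

text \<open>
  The supremum in \<open>R_impl\<close> is attained: every \<open>a\<close> strictly below it satisfies \<open>T x a \<le> y\<close> by
  monotonicity, and the inequality survives the limit from the left. When the supremum is 0
  there is no such \<open>a\<close>, but then \<open>T x 0 = 0\<close>.
\<close>

lemma T_R_impl_le:
  assumes x: "x \<in> {0..1}" and y: "y \<in> {0..1}"
  shows "T x (R_impl T x y) \<le> y"
proof (cases "R_impl T x y = 0")
  case True
  then show ?thesis
    using x y by (simp add: zero)
next
  case False
  define s where "s = R_impl T x y"
  have s: "s \<in> {0<..1}"
    using R_impl_closed[OF x y] False unfolding s_def by auto
  have "T x a \<le> y" if "0 < a" "a < s" for a
  proof -
    have "0 \<in> {a \<in> {0..1}. T x a \<le> y}"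
      using x y by (simp add: zero)
    then obtain b where b: "b \<in> {0..1}" "T x b \<le> y" "a < b"
      using less_cSupD[of "{a \<in> {0..1}. T x a \<le> y}" a] \<open>a < s\<close>
      unfolding s_def R_impl_def by blast
    with that s have "T x a \<le> T x b"
      by (intro mono_right[OF x]) auto
    with b show ?thesis
      by simp
  qed
  then have "\<forall>\<^sub>F a in at_left s. T x a \<le> y"
    using s by (auto simp: eventually_at_left[of 0 s])
  moreover have "(T x \<longlongrightarrow> T x s) (at_left s)"
    using left_continuous x s unfolding left_continuous_op_def continuous_within by blast
  ultimately show ?thesis
    unfolding s_def[symmetric] by (intro tendsto_upperbound) auto
qed

lemma le_R_impl_iff:
  assumes "x \<in> {0..1}" "y \<in> {0..1}" "a \<in> {0..1}"
  shows "a \<le> R_impl T x y \<longleftrightarrow> T x a \<le> y"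
proof
  assume "a \<le> R_impl T x y"
  then have "T x a \<le> T x (R_impl T x y)"
    using assms by (intro mono_right R_impl_closed)
  with T_R_impl_le[of x y] assms show "T x a \<le> y"
    by simp
next
  assume "T x a \<le> y"
  with assms show "a \<le> R_impl T x y"
    unfolding R_impl_def by (intro cSup_upper bdd_aboveI[of _ 1]) auto
qed

lemma R_impl_eq_1:
  assumes "x \<in> {0..1}" "y \<in> {0..1}" "x \<le> y"
  shows "R_impl T x y = 1"
  using le_R_impl_iff[of x y 1] R_impl_closed[of x y] assms by auto

section \<open>The biimplication\<close>

lemma bi_impl_closed:
  "\<lbrakk>x \<in> {0..1}; y \<in> {0..1}\<rbrakk> \<Longrightarrow> bi_impl T x y \<in> {0..1}"
  unfolding bi_impl_def by (intro closed R_impl_closed)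

lemma bi_impl_commute:
  "\<lbrakk>x \<in> {0..1}; y \<in> {0..1}\<rbrakk> \<Longrightarrow> bi_impl T x y = bi_impl T y x"
  unfolding bi_impl_def by (intro commute R_impl_closed)

lemma bi_impl_eq_R_impl:
  "\<lbrakk>x \<in> {0..1}; y \<in> {0..1}; x \<le> y\<rbrakk> \<Longrightarrow> bi_impl T x y = R_impl T y x"
  unfolding bi_impl_def by (simp only: R_impl_eq_1 one R_impl_closed)

text \<open>
  For \<open>x \<le> y\<close> the biimplication is \<open>R_impl T y x\<close>, so residuation gives the second inequality, and
  the first one holds trivially because \<open>T t x \<le> x\<close>. The other case is symmetric. For a lattice
  that is not a chain, the two inequalities would only bound \<open>t\<close> by the meet of the two residua,
  which may exceed their product.
\<close>

lemma le_bi_impl_iff: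
  assumes "x \<in> {0..1}" "y \<in> {0..1}" and t: "t \<in> {0..1}"
  shows "t \<le> bi_impl T x y \<longleftrightarrow> T t x \<le> y \<and> T t y \<le> x"
  using assms(1,2)
proof (induction x y rule: linorder_wlog)
  case (le x y)
  then have "t \<le> bi_impl T x y \<longleftrightarrow> T t y \<le> x"
    using t by (simp only: bi_impl_eq_R_impl le_R_impl_iff commute[of y t])
  moreover have "T t x \<le> y"
    using le_right[of t x] le t by simp
  ultimately show ?case
    by simp
next
  case (sym x y)
  then show ?case
    using bi_impl_commute[of x y] by auto
qed

section \<open>Transfer of degrees through the operations\<close>

lemma T_transfer:
  assumes "t \<in> {0..1}" "s \<in> {0..1}" "a \<in> {0..1}" "a' \<in> {0..1}" "b \<in> {0..1}" "b' \<in> {0..1}"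
    and "T t a \<le> a'" "T s b \<le> b'"
  shows "T (T t s) (T a b) \<le> T a' b'"
  using mono[of "T t a" a' "T s b" b'] interchange[of t s a b] assms by (simp only: closed)

text \<open>
  By residuation the claim reads \<open>T q (T (T t s) (R_impl T p c)) \<le> d\<close>. Regrouping brings \<open>t\<close>
  together with \<open>q\<close>, giving at most \<open>p\<close>; modus ponens then turns \<open>p\<close> and \<open>R_impl T p c\<close> into at
  most \<open>c\<close>, on which \<open>s\<close> acts.
\<close>

lemma R_impl_transfer:
  assumes "t \<in> {0..1}" "s \<in> {0..1}" "p \<in> {0..1}" "q \<in> {0..1}" "c \<in> {0..1}" "d \<in> {0..1}"
    and "T t q \<le> p" "T s c \<le> d"
  shows "T (T t s) (R_impl T p c) \<le> R_impl T q d"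
proof -
  let ?r = "R_impl T p c"
  have r: "?r \<in> {0..1}"
    using assms by (intro R_impl_closed)
  have "T q (T t s) = T s (T t q)"
    using assms by (simp only: commute[of t s] commute[of q "T s t"] assoc closed)
  then have "T q (T (T t s) ?r) = T (T s (T t q)) ?r"
    using assms r by (simp only: assoc[symmetric] closed)
  also have "\<dots> = T s (T (T t q) ?r)"
    using assms r by (intro assoc closed)
  also have "\<dots> \<le> T s (T p ?r)"
    using assms r by (intro mono_right mono_left closed)
  also have "\<dots> \<le> T s c"
    using assms r by (intro mono_right closed T_R_impl_le)
  also have "\<dots> \<le> d"
    by fact
  finally show ?thesis
    using assms r by (simp only: le_R_impl_iff closed)
qed

lemma SUP_closed:
  fixes f :: "'i \<Rightarrow> real"
  assumes "I \<noteq> {}" "\<And>i. i \<in> I \<Longrightarrow> f i \<in> {0..1}"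
  shows "(SUP i\<in>I. f i) \<in> {0..1}"
proof -
  obtain i where "i \<in> I"
    using assms by blast
  moreover have "bdd_above (f ` I)"
    using assms by (intro bdd_aboveI[of _ 1]) auto
  ultimately have "f i \<le> (SUP i\<in>I. f i)"
    by (intro cSUP_upper)
  moreover have "(SUP i\<in>I. f i) \<le> 1"
    using assms by (intro cSUP_least) auto
  ultimately show ?thesis
    using assms(2)[OF \<open>i \<in> I\<close>] by simp
qed

text \<open>
  Residuation moves \<open>t\<close> to the other side, where it becomes an upper bound that can be
  checked for each member of the family separately.
\<close>

lemma SUP_transfer:
  fixes f g :: "'i \<Rightarrow> real"
  assumes "I \<noteq> {}" and t: "t \<in> {0..1}"
    and f: "\<And>i. i \<in> I \<Longrightarrow> f i \<in> {0..1}" and g: "\<And>i. i \<in> I \<Longrightarrow> g i \<in> {0..1}"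
    and fg: "\<And>i. i \<in> I \<Longrightarrow> T t (f i) \<le> g i"
  shows "T t (SUP i\<in>I. f i) \<le> (SUP i\<in>I. g i)"
proof -
  let ?G = "SUP i\<in>I. g i"
  have G: "?G \<in> {0..1}"
    using \<open>I \<noteq> {}\<close> g by (rule SUP_closed)
  have bdd: "bdd_above (g ` I)"
    using g by (intro bdd_aboveI[of _ 1]) auto
  have "T t (f i) \<le> ?G" if "i \<in> I" for i
    using fg[OF that] cSUP_upper[OF that bdd] by (rule order_trans)
  then have "f i \<le> R_impl T t ?G" if "i \<in> I" for i
    using that le_R_impl_iff[OF t G f[OF that]] by simp
  then have "(SUP i\<in>I. f i) \<le> R_impl T t ?G"
    using \<open>I \<noteq> {}\<close> by (intro cSUP_least)
  then show ?thesis
    using le_R_impl_iff[OF t G SUP_closed[OF \<open>I \<noteq> {}\<close> f]] by simp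
qed

section \<open>Similarity of fuzzy sets and of inferred fuzzy sets\<close>

lemma sim_deg_closed:
  assumes "W \<noteq> {}" "fuzzy_set_on W C" "fuzzy_set_on W D"
  shows "sim_deg (bi_impl T) W C D \<in> {0..1}"
proof -
  have range: "bi_impl T (C w) (D w) \<in> {0..1}" if "w \<in> W" for w
    using assms that unfolding fuzzy_set_on_def by (intro bi_impl_closed) auto
  obtain w where "w \<in> W"
    using assms by blast
  moreover have "bdd_below ((\<lambda>w. bi_impl T (C w) (D w)) ` W)"
    using range by (intro bdd_belowI[of _ 0]) auto
  ultimately have "sim_deg (bi_impl T) W C D \<le> bi_impl T (C w) (D w)"
    unfolding sim_deg_def by (intro cINF_lower)
  moreover have "0 \<le> sim_deg (bi_impl T) W C D"
    unfolding sim_deg_def using assms range by (intro cINF_greatest) auto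
  ultimately show ?thesis
    using range[OF \<open>w \<in> W\<close>] by simp
qed

lemma similar_iff:
  assumes "W \<noteq> {}" "fuzzy_set_on W C" "fuzzy_set_on W D" and t: "t \<in> {0..1}"
  shows "similar (bi_impl T) W t C D \<longleftrightarrow> (\<forall>w\<in>W. T t (C w) \<le> D w \<and> T t (D w) \<le> C w)"
proof -
  have range: "C w \<in> {0..1}" "D w \<in> {0..1}" if "w \<in> W" for w
    using assms that unfolding fuzzy_set_on_def by auto
  have "bdd_below ((\<lambda>w. bi_impl T (C w) (D w)) ` W)"
    using range bi_impl_closed by (intro bdd_belowI[of _ 0]) force
  then have "similar (bi_impl T) W t C D \<longleftrightarrow> (\<forall>w\<in>W. t \<le> bi_impl T (C w) (D w))"
    unfolding similar_def sim_deg_def using \<open>W \<noteq> {}\<close> by (simp add: le_cINF_iff)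
  then show ?thesis
    using le_bi_impl_iff[OF range t] by simp
qed

text \<open>
  The fuzzy set inferred from the rule \<open>A\<close>, \<open>B\<close> when the input matches \<open>A\<close> to the degree \<open>p\<close>.
\<close>

definition inferred :: "'u set \<Rightarrow> real \<Rightarrow> ('u \<Rightarrow> real) \<Rightarrow> ('v \<Rightarrow> real) \<Rightarrow> 'v \<Rightarrow> real" where
  "inferred U p A B y = (SUP x\<in>U. R_impl T p (T (A x) (B y)))"

lemma inferred_closed:
  assumes "U \<noteq> {}" "p \<in> {0..1}" "fuzzy_set_on U A" "fuzzy_set_on V B"
  shows "fuzzy_set_on V (inferred U p A B)"
proof -
  have "R_impl T p (T (A x) (B y)) \<in> {0..1}" if "x \<in> U" "y \<in> V" for x y
    using assms that by (simp only: fuzzy_set_on_def R_impl_closed closed)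
  then show ?thesis
    unfolding fuzzy_set_on_def inferred_def using \<open>U \<noteq> {}\<close> by (intro ballI SUP_closed)
qed

text \<open>
  The directions of the hypotheses follow the monotonicity of the operations: \<open>t\<close> has to push
  \<open>q\<close> below \<open>p\<close>, since the residuum is antitone in its first argument, whereas \<open>s\<close> and \<open>r\<close> act
  from the left-hand fuzzy sets to the right-hand ones.
\<close>

lemma inferred_transfer:
  assumes "U \<noteq> {}" and pq: "p \<in> {0..1}" "q \<in> {0..1}"
    and ts: "t \<in> {0..1}" "s \<in> {0..1}" "r \<in> {0..1}"
    and A: "\<And>x. x \<in> U \<Longrightarrow> A x \<in> {0..1}" "\<And>x. x \<in> U \<Longrightarrow> A' x \<in> {0..1}"
    and B: "B y \<in> {0..1}" "B' y \<in> {0..1}"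
    and le: "T t q \<le> p" "\<And>x. x \<in> U \<Longrightarrow> T s (A x) \<le> A' x" "T r (B y) \<le> B' y"
  shows "T (T t (T s r)) (inferred U p A B y) \<le> inferred U q A' B' y"
proof -
  have "T (T t (T s r)) (R_impl T p (T (A x) (B y))) \<le> R_impl T q (T (A' x) (B' y))"
    if "x \<in> U" for x
    by (rule R_impl_transfer[OF ts(1) closed[OF ts(2,3)] pq closed[OF A(1)[OF that] B(1)]
          closed[OF A(2)[OF that] B(2)] le(1)
          T_transfer[OF ts(2,3) A(1)[OF that] A(2)[OF that] B le(2)[OF that] le(3)]])
  moreover have "R_impl T p (T (A x) (B y)) \<in> {0..1}" "R_impl T q (T (A' x) (B' y)) \<in> {0..1}"
    if "x \<in> U" for x
    using A[OF that] B pq by (blast intro: R_impl_closed closed)+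
  moreover have "T t (T s r) \<in> {0..1}"
    using ts by (blast intro: closed)
  ultimately show ?thesis
    unfolding inferred_def using \<open>U \<noteq> {}\<close> by (intro SUP_transfer)
qed

end

theorem theorem4p11:
  fixes T F :: "real \<Rightarrow> real \<Rightarrow> real"
    and U :: "'u set" and V :: "'v set"
    and A A' A'' A1 :: "'u \<Rightarrow> real" and B B1 B1' B1'' :: "'v \<Rightarrow> real"
    and \<alpha>1 \<alpha>2 \<alpha>3 \<beta> :: real
  assumes "t_norm T" and "left_continuous_op T"
    and F: "F = bi_impl T"
    and "U \<noteq> {}" and "V \<noteq> {}"
    and "fuzzy_set_on U A" and "fuzzy_set_on U A'"
    and "fuzzy_set_on U A''" and "fuzzy_set_on U A1"
    and "fuzzy_set_on V B" and "fuzzy_set_on V B1"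
    and "\<alpha>1 \<in> {0..1}" and "\<alpha>2 \<in> {0..1}" and "\<alpha>3 \<in> {0..1}"
    and B1': "\<And>y. y \<in> V \<Longrightarrow> B1' y = (SUP x\<in>U. R_impl T (sim_deg F U A' A) (T (A x) (B y)))"
    and B1'': "\<And>y. y \<in> V \<Longrightarrow> B1'' y = (SUP x\<in>U. R_impl T (sim_deg F U A'' A1) (T (A1 x) (B1 y)))"
    and "similar F U \<alpha>1 A' A''" and "similar F U \<alpha>2 A A1" and "similar F V \<alpha>3 B B1"
    and \<beta>: "\<beta> = F (sim_deg F U A' A) (sim_deg F U A'' A1)"
  shows "similar F V (T3 T \<beta> \<alpha>2 \<alpha>3) B1' B1''"
proof -
  interpret left_continuous_t_norm T
    using \<open>t_norm T\<close> \<open>left_continuous_op T\<close> by unfold_locales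
  define p where "p = sim_deg F U A' A"
  define q where "q = sim_deg F U A'' A1"
  have p: "p \<in> {0..1}" and q: "q \<in> {0..1}"
    using sim_deg_closed[OF \<open>U \<noteq> {}\<close> \<open>fuzzy_set_on U A'\<close> \<open>fuzzy_set_on U A\<close>]
      sim_deg_closed[OF \<open>U \<noteq> {}\<close> \<open>fuzzy_set_on U A''\<close> \<open>fuzzy_set_on U A1\<close>]
    by (simp_all only: p_def q_def F)
  have \<beta>_closed: "\<beta> \<in> {0..1}"
    using bi_impl_closed[OF p q] by (simp only: \<beta> F p_def q_def)
  have pq: "T \<beta> p \<le> q" "T \<beta> q \<le> p"
    using le_bi_impl_iff[OF p q \<beta>_closed] unfolding \<beta> p_def q_def F by auto
  note fuzzy_sets =
    \<open>fuzzy_set_on U A\<close> \<open>fuzzy_set_on U A1\<close> \<open>fuzzy_set_on V B\<close> \<open>fuzzy_set_on V B1\<close>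
  note \<alpha> = \<open>\<alpha>2 \<in> {0..1}\<close> \<open>\<alpha>3 \<in> {0..1}\<close>
  have A: "A x \<in> {0..1}" "A1 x \<in> {0..1}" if "x \<in> U" for x
    using fuzzy_sets that unfolding fuzzy_set_on_def by auto
  have B: "B y \<in> {0..1}" "B1 y \<in> {0..1}" if "y \<in> V" for y
    using fuzzy_sets that unfolding fuzzy_set_on_def by auto
  have AA1: "T \<alpha>2 (A x) \<le> A1 x" "T \<alpha>2 (A1 x) \<le> A x" if "x \<in> U" for x
    using \<open>similar F U \<alpha>2 A A1\<close> that
      similar_iff[OF \<open>U \<noteq> {}\<close> fuzzy_sets(1,2) \<alpha>(1)] unfolding F by blast+
  have BB1: "T \<alpha>3 (B y) \<le> B1 y" "T \<alpha>3 (B1 y) \<le> B y" if "y \<in> V" for y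
    using \<open>similar F V \<alpha>3 B B1\<close> that
      similar_iff[OF \<open>V \<noteq> {}\<close> fuzzy_sets(3,4) \<alpha>(2)] unfolding F by blast+
  have B1'_eq: "B1' y = inferred U p A B y" and B1''_eq: "B1'' y = inferred U q A1 B1 y"
    if "y \<in> V" for y
    using that unfolding inferred_def p_def q_def by (simp_all only: B1' B1'')
  have fuzzy: "fuzzy_set_on V B1'" "fuzzy_set_on V B1''"
    using inferred_closed[OF \<open>U \<noteq> {}\<close> p fuzzy_sets(1,3)]
      inferred_closed[OF \<open>U \<noteq> {}\<close> q fuzzy_sets(2,4)]
    by (simp_all add: fuzzy_set_on_def B1'_eq B1''_eq)
  let ?t = "T \<beta> (T \<alpha>2 \<alpha>3)"
  have t: "?t \<in> {0..1}"
    using \<beta>_closed \<alpha> by (intro closed)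
  have "T ?t (B1' y) \<le> B1'' y" if "y \<in> V" for y
    unfolding B1'_eq[OF that] B1''_eq[OF that]
    by (rule inferred_transfer[OF \<open>U \<noteq> {}\<close> p q \<beta>_closed \<alpha>])
      (use that A B AA1 BB1 pq in blast)+
  moreover have "T ?t (B1'' y) \<le> B1' y" if "y \<in> V" for y
    unfolding B1'_eq[OF that] B1''_eq[OF that]
    by (rule inferred_transfer[OF \<open>U \<noteq> {}\<close> q p \<beta>_closed \<alpha>])
      (use that A B AA1 BB1 pq in blast)+
  ultimately have "similar F V ?t B1' B1''"
    by (simp add: F similar_iff[OF \<open>V \<noteq> {}\<close> fuzzy t])
  moreover have "T3 T \<beta> \<alpha>2 \<alpha>3 = ?t"
    unfolding T3_def using \<beta>_closed \<alpha> by (intro assoc)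
  ultimately show ?thesis
    by simp
qed

end
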